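(* If $G$ is a finite strongly connected digraph that is not a directed cycle, then the metric dimension of its line graph satisfies $$\mu(L(G)) = |E(G)| - |V(G)|.$$
   Context: Digraphs are finite; $V(G)$ denotes the vertex set and $E(G)$ the set of directed edges of $G$, where a directed edge is an ordered pair $(x,y)$ of vertices. Self-loops $(x,x)$ are allowed; there are no multiple edges. $G$ is strongly connected if for any two distinct vertices $u,v$ there is a directed path from $u$ to $v$. A directed cycle is a digraph with distinct vertices $v_1,\ldots,v_k$ ($k\geq 1$) and edges exactly $(v_1,v_2),\ldots,(v_{k-1},v_k),(v_k,v_1)$; this includes length 1 (a single vertex with a loop) and length 2. The distance $d_G(u,v)$ from $u$ to $v$ is the length of a shortest directed path from $u$ to $v$ (with $d_G(u,u)=0$). The line graph $L(G)$ of a digraph $G$ is the digraph whose vertices are the edges of $G$, and in which $(a,b)$, with $a=(x_1,x_2)$ and $b=(y_1,y_2)$ in $E(G)$, is a directed edge if and only if $x_2=y_1$. A resolving set of a strongly connected digraph $H$ is a set $W=\{w_1,\ldots,w_m\}$ of vertices such that each vertex $u$ of $H$ is uniquely determined by the vector $D(u|W)=(d_H(u,w_1),\ldots,d_H(u,w_m))$, i.e. distinct vertices have distinct vectors. The metric dimension $\mu(H)$ is the minimum cardinality of a resolving set of $H$.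
   Formalization: The digraph is assumed to be nonempty and to have at least one edge: for a single vertex with no edges the line graph is empty, so its metric dimension is 0 (or undefined), while |E(G)| - |V(G)| = -1. *)

theory Defs
  imports "Graph_Theory.Graph_Theory"
begin

text \<open>
  Digraphs with loops but without multiple edges are the records
  \<open>'a pair_pre_digraph\<close>, whose arcs form a set of ordered pairs.
\<close>

definition line_graph :: "'a pair_pre_digraph \<Rightarrow> ('a \<times> 'a) pair_pre_digraph" where
  "line_graph G =
     \<lparr> pverts = parcs G,
       parcs = {(a, b). a \<in> parcs G \<and> b \<in> parcs G \<and> snd a = fst b} \<rparr>"

text \<open>
  For \<open>vs = [v]\<close> the only edge is the loop \<open>(v, v)\<close>.
\<close>

definition directed_cycle :: "'a pair_pre_digraph \<Rightarrow> bool" where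
  "directed_cycle G \<longleftrightarrow>
     (\<exists>vs. vs \<noteq> [] \<and> distinct vs \<and> pverts G = set vs \<and>
        parcs G = {(vs ! i, vs ! (Suc i mod length vs)) | i. i < length vs})"

text \<open>
  The library's weighted distance with all weights equal to \<open>1\<close>, that is, the
  length of a shortest directed path; it is \<open>\<infinity>\<close> if there is none.
  See \<open>digraph_dist_apath\<close> below.
\<close>

definition digraph_dist :: "('a, 'b) pre_digraph \<Rightarrow> 'a \<Rightarrow> 'a \<Rightarrow> ereal" where
  "digraph_dist G u v = wf_digraph.\<mu> G (\<lambda>_. 1) u v"

definition resolving_set :: "('a, 'b) pre_digraph \<Rightarrow> 'a set \<Rightarrow> bool" where
  "resolving_set G W \<longleftrightarrow> W \<subseteq> verts G \<and>
     (\<forall>u \<in> verts G. \<forall>v \<in> verts G.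
        (\<forall>w \<in> W. digraph_dist G u w = digraph_dist G v w) \<longrightarrow> u = v)"

text \<open>
  Meant for finite digraphs only, since \<open>card\<close> is \<open>0\<close> on infinite sets.
\<close>

definition metric_dimension :: "('a, 'b) pre_digraph \<Rightarrow> nat" where
  "metric_dimension G = (LEAST n. \<exists>W. resolving_set G W \<and> card W = n)"

lemma pair_fin_digraph_line_graph:
  assumes "pair_fin_digraph G"
  shows "pair_fin_digraph (line_graph G)"
proof -
  interpret pair_fin_digraph G by fact
  have "finite (parcs G \<times> parcs G)"
    using pair_finite_arcs by simp
  then have "finite {(a, b). a \<in> parcs G \<and> b \<in> parcs G \<and> snd a = fst b}"
    by (rule rev_finite_subset) auto
  then show ?thesis
    using pair_finite_arcs by unfold_locales (auto simp: line_graph_def)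
qed

lemma digraph_dist_apath:
  assumes "fin_digraph G" and "u \<rightarrow>\<^sup>*\<^bsub>G\<^esub> v"
  shows "digraph_dist G u v
           = ereal (real (LEAST n. \<exists>p. pre_digraph.apath G u p v \<and> length p = n))"
proof -
  interpret fin_digraph G by fact
  have cost: "awalk_cost (\<lambda>_. 1) p = real (length p)" for p :: "'b list"
    by (induct p) auto
  obtain p where p: "apath u p v" "\<mu> (\<lambda>_. 1) u v = awalk_cost (\<lambda>_. 1) p"
    using min_cost_awalk[OF assms(2), of "\<lambda>_. 1"] by auto
  have "(LEAST n. \<exists>p. apath u p v \<and> length p = n) = length p"
  proof (rule Least_equality)
    show "\<exists>q. apath u q v \<and> length q = length p"
      using p(1) by blast
  next
    fix n assume "\<exists>q. apath u q v \<and> length q = n"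
    then obtain q where q: "apath u q v" "length q = n" by blast
    then have "\<mu> (\<lambda>_. 1) u v \<le> awalk_cost (\<lambda>_. 1) q"
      by (intro min_cost_le_walk_cost) (simp add: apath_def)
    then show "length p \<le> n"
      using p(2) q(2) by (simp add: cost)
  qed
  then show ?thesis
    using p(2) by (simp add: digraph_dist_def cost)
qed

end

(*
Two edges with the same head have the same distance to every other vertex of L(G), so a
resolving set misses at most one edge into each vertex; this gives at least |E| - |V| elements.

Conversely, let W arise from E by omitting one edge e v into each vertex v. If W is empty,
every vertex has exactly one predecessor and strong connectedness makes G a directed cycle.
Otherwise take an edge a and a shortest walk in L(G) from a to W, of length k and with end w.
All its vertices but the last lie outside W, so each is e v for the tail v of its successor;
hence a is recovered from w and k by k backward steps, and w and k are determined by the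
distances from a to W.
*)
theory Submission
  imports Defs
begin

section \<open>Distances in terms of powers of the arc relation\<close>

lemma (in wf_digraph) ex_awalk_length_iff:
  assumes "u \<in> verts G"
  shows "(\<exists>p. awalk u p v \<and> length p = n) \<longleftrightarrow> (u, v) \<in> arcs_ends G ^^ n"
  using assms
proof (induction n arbitrary: u)
  case 0
  then show ?case by (auto simp: awalk_Nil_iff)
next
  case (Suc n)
  have "(\<exists>p. awalk u p v \<and> length p = Suc n) \<longleftrightarrow>
      (\<exists>e \<in> arcs G. tail G e = u \<and> (\<exists>p. awalk (head G e) p v \<and> length p = n))"
  proof
    assume "\<exists>p. awalk u p v \<and> length p = Suc n"
    then obtain e p where "awalk u (e # p) v" "length p = n"
      by (auto simp: length_Suc_conv)
    then show "\<exists>e \<in> arcs G. tail G e = u \<and> (\<exists>p. awalk (head G e) p v \<and> length p = n)"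
      by (metis awalk_Cons_iff)
  next
    assume "\<exists>e \<in> arcs G. tail G e = u \<and> (\<exists>p. awalk (head G e) p v \<and> length p = n)"
    then obtain e p where "awalk u (e # p) v" "length (e # p) = Suc n"
      by (auto simp: awalk_Cons_iff)
    then show "\<exists>p. awalk u p v \<and> length p = Suc n" by blast
  qed
  also have "\<dots> \<longleftrightarrow> (\<exists>e \<in> arcs G. tail G e = u \<and> (head G e, v) \<in> arcs_ends G ^^ n)"
    using Suc.IH by (auto simp: head_in_verts)
  also have "\<dots> \<longleftrightarrow> (u, v) \<in> arcs_ends G ^^ Suc n"
    \<comment> \<open>\<open>relpow\<close> splits off the last step; commuting exposes the first
      one, matching the arc \<open>e\<close> in front of the walk.\<close>
    unfolding relpow.simps(2) relpow_commute[symmetric]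
    by (auto simp: arcs_ends_conv relcomp_unfold)
  finally show ?case .
qed

text \<open>The infimum also covers an unreachable \<open>v\<close>: the index set is then empty and
  both sides are \<infinity>.\<close>

lemma (in wf_digraph) digraph_dist_eq_INF:
  assumes "u \<in> verts G"
  shows "digraph_dist G u v = (INF n \<in> {n. (u, v) \<in> arcs_ends G ^^ n}. ereal (real n))"
proof -
  have cost: "awalk_cost (\<lambda>_. 1) p = real (length p)" for p :: "'b list"
    by (induct p) auto
  have "{n. (u, v) \<in> arcs_ends G ^^ n} = length ` {p. awalk u p v}"
    by (auto simp: image_iff simp flip: ex_awalk_length_iff[OF assms])
  then show ?thesis
    by (simp add: digraph_dist_def \<mu>_def cost image_image)
qed

lemma (in wf_digraph) digraph_dist_eq_Least:
  assumes "u \<in> verts G" and "(u, v) \<in> arcs_ends G ^^ n"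
  shows "digraph_dist G u v = ereal (real (LEAST n. (u, v) \<in> arcs_ends G ^^ n))"
  unfolding digraph_dist_eq_INF[OF assms(1)]
proof (rule antisym)
  show "(INF n \<in> {n. (u, v) \<in> arcs_ends G ^^ n}. ereal (real n))
      \<le> ereal (real (LEAST n. (u, v) \<in> arcs_ends G ^^ n))"
    using LeastI[of "\<lambda>n. (u, v) \<in> arcs_ends G ^^ n", OF assms(2)]
    by (intro INF_lower) simp
qed (auto intro!: INF_greatest Least_le)

text \<open>No vertex before the end of a walk of length \<open>k\<close> from \<open>a\<close> to
  \<open>w\<close> lies in \<open>W\<close>, since it would give a shorter way into
  \<open>W\<close>. So \<open>g\<close> recovers each vertex from its successor, all the way back
  from \<open>w\<close>.\<close>

lemma relpow_dist_parent:
  assumes "(a, w) \<in> R ^^ k" and "w \<in> W"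
    and "\<And>j w'. j < k \<Longrightarrow> w' \<in> W \<Longrightarrow> (a, w') \<notin> R ^^ j"
    and parent: "\<And>a b. (a, b) \<in> R \<Longrightarrow> a \<notin> W \<Longrightarrow> a = g b"
  shows "a = (g ^^ k) w"
  using assms(1,3)
proof (induction k arbitrary: a)
  case 0
  then show ?case by simp
next
  case (Suc k)
  obtain c where c: "(a, c) \<in> R" "(c, w) \<in> R ^^ k"
    using Suc.prems(1) by (metis relpow_Suc_D2)
  have "c = (g ^^ k) w"
  proof (rule Suc.IH[OF c(2)])
    show "(c, w') \<notin> R ^^ j" if "j < k" "w' \<in> W" for j w'
      using Suc.prems(2)[of "Suc j" w'] that relpow_Suc_I2[OF c(1)] by blast
  qed
  moreover have "a \<notin> W"
    using Suc.prems(2)[of 0 a] by auto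
  ultimately show ?case
    using parent[OF c(1)] by simp
qed

section \<open>Walks and distances in the line graph\<close>

lemma line_graph_simps [simp]:
  "pverts (line_graph G) = parcs G"
  "(a, b) \<in> parcs (line_graph G) \<longleftrightarrow> a \<in> parcs G \<and> b \<in> parcs G \<and> snd a = fst b"
  by (simp_all add: line_graph_def)

context pair_fin_digraph
begin

lemma wf_digraph_line_graph: "wf_digraph (line_graph G)"
proof -
  interpret L: pair_fin_digraph "line_graph G"
    by (rule pair_fin_digraph_line_graph) unfold_locales
  show ?thesis by unfold_locales
qed

text \<open>The arcs of a walk in \<open>G\<close> from the head of \<open>a\<close> to the tail of
  \<open>b\<close>, put between \<open>a\<close> and \<open>b\<close>, form a walk in the line
  graph.\<close>

lemma line_graph_relpow_of_reachable:
  assumes "x \<rightarrow>\<^sup>*\<^bsub>G\<^esub> fst b" and "a \<in> parcs G" and "snd a = x" and "b \<in> parcs G"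
  shows "\<exists>n. (a, b) \<in> parcs (line_graph G) ^^ n"
  using assms
proof (induction arbitrary: a rule: converse_reachable_induct)
  case base
  then have "(a, b) \<in> parcs (line_graph G) ^^ 1" by simp
  then show ?case by blast
next
  case (step x y)
  then have "(x, y) \<in> parcs G" by simp
  with step.IH[of "(x, y)"] step.prems
  obtain n where "((x, y), b) \<in> parcs (line_graph G) ^^ n" by auto
  moreover have "(a, (x, y)) \<in> parcs (line_graph G)"
    using step.prems \<open>(x, y) \<in> parcs G\<close> by simp
  ultimately show ?case by (blast intro: relpow_Suc_I2)
qed

text \<open>Both arcs have the same successors in the line graph, so walks to \<open>w\<close>
  differ only in their start; \<open>w\<close> being neither arc rules out length 0.\<close>

lemma line_graph_dist_eq_of_same_head:
  assumes "a \<in> parcs G" "a' \<in> parcs G" "snd a = snd a'" "w \<noteq> a" "w \<noteq> a'"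
  shows "digraph_dist (line_graph G) a w = digraph_dist (line_graph G) a' w"
proof -
  interpret L: wf_digraph "line_graph G" by (rule wf_digraph_line_graph)
  have "(a, w) \<in> parcs (line_graph G) ^^ n \<longleftrightarrow> (a', w) \<in> parcs (line_graph G) ^^ n" for n
  proof (cases n)
    case 0
    then show ?thesis using assms by auto
  next
    case (Suc m)
    then show ?thesis
      using assms unfolding Suc relpow.simps(2) relpow_commute[symmetric]
      by (auto simp: relcomp_unfold)
  qed
  then show ?thesis
    using assms by (simp add: L.digraph_dist_eq_INF)
qed

section \<open>The lower bound, and resolving sets that attain it\<close>

lemma resolving_set_line_graph_card_ge:
  assumes "resolving_set (line_graph G) W"
  shows "card (parcs G) \<le> card W + card (pverts G)"
proof -
  have W: "W \<subseteq> parcs G"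
    using assms by (simp add: resolving_set_def)
  \<comment> \<open>Two arcs outside \<open>W\<close> with a common head would not be told apart by
    \<open>W\<close>.\<close>
  have "inj_on snd (parcs G - W)"
  proof (rule inj_onI)
    fix a a' assume "a \<in> parcs G - W" "a' \<in> parcs G - W" "snd a = snd a'"
    moreover from this have "digraph_dist (line_graph G) a w = digraph_dist (line_graph G) a' w"
      if "w \<in> W" for w
      using that by (intro line_graph_dist_eq_of_same_head) auto
    ultimately show "a = a'"
      using assms by (auto simp: resolving_set_def)
  qed
  moreover have "snd ` (parcs G - W) \<subseteq> pverts G"
    using in_arcsD2 by fastforce
  ultimately have "card (parcs G - W) \<le> card (pverts G)"
    by (intro card_inj_on_le) auto
  then show ?thesis
    using W card_Diff_subset[OF finite_subset[OF W] W] by simp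
qed

text \<open>As the set is nonempty, \<open>a\<close> has a nearest element \<open>w\<close> in it.
  If \<open>a'\<close> has the same distances, the same number of backward steps from
  \<open>w\<close> leads to both arcs.\<close>

lemma resolving_set_line_graph_omit_in_arcs:
  assumes sc: "strongly_connected G"
    and e: "\<And>v. v \<in> pverts G \<Longrightarrow> e v \<in> parcs G \<and> snd (e v) = v"
    and ne: "parcs G - e ` pverts G \<noteq> {}"
  shows "resolving_set (line_graph G) (parcs G - e ` pverts G)"
  unfolding resolving_set_def
proof (intro conjI ballI impI)
  interpret L: wf_digraph "line_graph G" by (rule wf_digraph_line_graph)
  let ?W = "parcs G - e ` pverts G"
  let ?R = "parcs (line_graph G)"
  show "?W \<subseteq> verts (line_graph G)" by auto
  fix a a' assume "a \<in> verts (line_graph G)" "a' \<in> verts (line_graph G)"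
  then have a: "a \<in> parcs G" "a' \<in> parcs G" by auto
  assume eq: "\<forall>w\<in>?W. digraph_dist (line_graph G) a w = digraph_dist (line_graph G) a' w"
  have reach: "\<exists>n. (b, w) \<in> ?R ^^ n" if "b \<in> parcs G" "w \<in> parcs G" for b w
  proof (rule line_graph_relpow_of_reachable[of "snd b"])
    show "snd b \<rightarrow>\<^sup>*\<^bsub>G\<^esub> fst w"
      using sc that in_arcsD2[of "fst b" "snd b"] in_arcsD1[of "fst w" "snd w"]
      by (auto simp: strongly_connected_def)
  qed (use that in auto)
  let ?d = "\<lambda>b w. LEAST n. (b, w) \<in> ?R ^^ n"
  have d_eq: "?d a w = ?d a' w" if w: "w \<in> ?W" for w
  proof -
    obtain n n' where "(a, w) \<in> ?R ^^ n" "(a', w) \<in> ?R ^^ n'"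
      using w reach[OF a(1), of w] reach[OF a(2), of w] by blast
    then show ?thesis
      using eq[rule_format, OF w] a
      by (simp add: L.digraph_dist_eq_Least[of _ _ n] L.digraph_dist_eq_Least[of _ _ n'])
  qed
  \<comment> \<open>The distance from \<open>a\<close> to the set \<open>?W\<close>; by
    \<open>d_eq\<close> it is that of \<open>a'\<close> too.\<close>
  define k where "k = (LEAST k. \<exists>w\<in>?W. ?d a w = k)"
  have "\<exists>w\<in>?W. ?d a w = k"
    unfolding k_def by (rule LeastI_ex) (use ne in blast)
  then obtain w where w: "w \<in> ?W" "?d a w = k" by blast
  have k_le: "k \<le> ?d a w'" if "w' \<in> ?W" for w'
    unfolding k_def by (rule Least_le) (use that in blast)
  \<comment> \<open>An arc outside \<open>?W\<close> is \<open>e v\<close> for its own head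
    \<open>v\<close>, and the head of \<open>b\<close> is the tail of \<open>c\<close>.\<close>
  have parent: "b = e (fst c)" if "(b, c) \<in> ?R" "b \<notin> ?W" for b c
    using that e by force
  have walk: "b = ((\<lambda>c. e (fst c)) ^^ k) w"
    if b: "b \<in> parcs G" "\<And>w'. w' \<in> ?W \<Longrightarrow> ?d a w' = ?d b w'" for b
  proof (rule relpow_dist_parent[where R = ?R, OF _ w(1) _ parent])
    show "(b, w) \<in> ?R ^^ k"
      using LeastI_ex[OF reach[OF b(1), of w]] b(2) w by simp
    show "(b, w') \<notin> ?R ^^ j" if "j < k" "w' \<in> ?W" for j w'
      using that k_le[of w'] b(2)[of w'] Least_le[of "\<lambda>n. (b, w') \<in> ?R ^^ n" j] by auto
  qed
  show "a = a'"
    using walk[OF a(1)] walk[OF a(2) d_eq] by simp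
qed

section \<open>Arcs into each vertex, and the cycle as the case of exactly one each\<close>

lemma ex_in_arc:
  assumes "strongly_connected G" and "parcs G \<noteq> {}" and "v \<in> pverts G"
  shows "\<exists>a \<in> parcs G. snd a = v"
proof -
  \<comment> \<open>Starting from an arc settles \<open>v = q\<close>, where the walk from
    \<open>q\<close> to \<open>v\<close> may be empty. A single vertex without arcs is strongly
    connected but has no arc into it.\<close>
  obtain p q where pq: "(p, q) \<in> parcs G"
    using assms(2) by auto
  then have "q \<rightarrow>\<^sup>*\<^bsub>G\<^esub> v"
    using assms(1,3) in_arcsD2 by (auto simp: strongly_connected_def)
  then show ?thesis
  proof (induction rule: reachable_induct)
    case base
    show ?case using pq by (intro bexI[of _ "(p, q)"]) simp_all
  next
    case (step x y)
    then show ?case by (intro bexI[of _ "(x, y)"]) simp_all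
  qed
qed

text \<open>\<open>f\<close> sends each vertex to its only predecessor. Strong connectedness puts
  all vertices on one orbit of \<open>f\<close>, which closes up and runs against the arcs.\<close>

lemma directed_cycleI:
  assumes sc: "strongly_connected G"
    and arcs: "parcs G = (\<lambda>v. (f v, v)) ` pverts G"
  shows "directed_cycle G"
proof -
  obtain v where v: "v \<in> pverts G"
    using sc by (auto simp: strongly_connected_def)
  have f: "f u \<in> pverts G" if "u \<in> pverts G" for u
    using that in_arcsD1[of "f u" u] arcs by auto
  have orbit: "(f ^^ n) v \<in> pverts G" for n
    by (induction n) (auto simp: v f)
  have reach: "\<exists>n. u = (f ^^ n) u'" if "u \<in> pverts G" "u' \<in> pverts G" for u u'
  proof -
    have "u \<rightarrow>\<^sup>*\<^bsub>G\<^esub> u'"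
      using sc that by (auto simp: strongly_connected_def)
    then show ?thesis
    proof (induction rule: converse_reachable_induct)
      case base
      have "u' = (f ^^ 0) u'" by simp
      then show ?case by blast
    next
      case (step x y)
      then obtain n where "y = (f ^^ n) u'" by blast
      moreover have "x = f y" using step arcs by auto
      ultimately have "x = (f ^^ Suc n) u'" by simp
      then show ?case by blast
    qed
  qed
  \<comment> \<open>A walk from \<open>v\<close> to its predecessor \<open>f v\<close> gives
    \<open>v\<close> as an iterate of \<open>f v\<close>, so the exponent is positive after adding
    one.\<close>
  have "\<exists>n>0. (f ^^ n) v = v"
    using reach[OF v f[OF v]] by (metis funpow_Suc_right comp_apply zero_less_Suc)
  define n where "n = (LEAST n. n > 0 \<and> (f ^^ n) v = v)"
  have n: "n > 0" "(f ^^ n) v = v"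
    using LeastI_ex[OF \<open>\<exists>n>0. (f ^^ n) v = v\<close>] by (auto simp: n_def)
  have n_min: "(f ^^ m) v \<noteq> v" if "0 < m" "m < n" for m
    using not_less_Least[of m "\<lambda>n. n > 0 \<and> (f ^^ n) v = v"] that by (auto simp: n_def)
  have verts: "pverts G = (\<lambda>i. (f ^^ i) v) ` {..<n}"
  proof
    show "pverts G \<subseteq> (\<lambda>i. (f ^^ i) v) ` {..<n}"
    proof
      fix u assume "u \<in> pverts G"
      then obtain m where "u = (f ^^ m) v" using reach v by blast
      then have "u = (f ^^ (m mod n)) v" using funpow_mod_eq[OF n(2)] by simp
      then show "u \<in> (\<lambda>i. (f ^^ i) v) ` {..<n}" using n(1) by simp
    qed
  qed (use orbit in auto)
  \<comment> \<open>Reversed, because \<open>f\<close> goes backwards along arcs.\<close>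
  define vs where "vs = map (\<lambda>i. (f ^^ i) v) (rev [0..<n])"
  have len: "length vs = n" by (simp add: vs_def)
  have set_vs: "set vs = pverts G"
    by (simp add: vs_def verts atLeast0LessThan)
  have nth_vs: "vs ! i = (f ^^ (n - 1 - i)) v" if "i < n" for i
    using that by (simp add: vs_def rev_nth)
  have f_vs: "f (vs ! i) = (f ^^ (n - i)) v" if "i < n" for i
    using that by (simp add: nth_vs Suc_diff_Suc flip: funpow.simps(2) comp_apply[of f])
  have succ: "vs ! i = f (vs ! (Suc i mod n))" if "i < n" for i
  proof (cases "Suc i = n")
    case True
    then show ?thesis using f_vs[OF n(1)] nth_vs[OF that] n(2) by auto
  next
    case False
    then show ?thesis using that by (simp add: f_vs nth_vs[OF that])
  qed
  \<comment> \<open>Rotating lines up each head with its tail: entry \<open>i\<close> of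
    \<open>rotate1 vs\<close> is the successor of \<open>vs ! i\<close>.\<close>
  have "parcs G = (\<lambda>v. (f v, v)) ` set (rotate1 vs)"
    by (simp add: arcs set_vs)
  also have "\<dots> = {(f (rotate1 vs ! i), rotate1 vs ! i) | i. i < n}"
    unfolding set_conv_nth length_rotate1 len by blast
  also have "\<dots> = {(vs ! i, vs ! (Suc i mod length vs)) | i. i < length vs}"
    unfolding len by (rule Collect_cong) (metis succ nth_rotate1 len)
  finally have "parcs G = {(vs ! i, vs ! (Suc i mod length vs)) | i. i < length vs}" .
  moreover have "distinct vs"
    using inj_on_funpow_least[OF n(2) n_min] by (simp add: vs_def distinct_map)
  ultimately show ?thesis
    unfolding directed_cycle_def
    by (intro exI[of _ vs] conjI) (use set_vs v in auto)
qed

end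

theorem theorem2p1:
  fixes G :: "'a pair_pre_digraph"
  assumes "pair_fin_digraph G"
    and "strongly_connected G"
    and "\<not> directed_cycle G"
    and "parcs G \<noteq> {}"
  shows "int (metric_dimension (line_graph G)) = int (card (parcs G)) - int (card (pverts G))"
proof -
  interpret pair_fin_digraph G by fact
  obtain e where e: "\<And>v. v \<in> pverts G \<Longrightarrow> e v \<in> parcs G \<and> snd (e v) = v"
    using ex_in_arc[OF assms(2,4)] by metis
  let ?W = "parcs G - e ` pverts G"
  have sub: "e ` pverts G \<subseteq> parcs G"
    using e by auto
  have "inj_on e (pverts G)"
    using e by (metis inj_onI)
  \<comment> \<open>\<open>le\<close> ensures that the subtraction on naturals in
    \<open>card\<close> is not truncated.\<close>
  then have card: "card ?W = card (parcs G) - card (pverts G)"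
    and le: "card (pverts G) \<le> card (parcs G)"
    using sub by (auto simp: card_Diff_subset card_image intro: card_inj_on_le)
  have "?W \<noteq> {}"
  proof
    assume "?W = {}"
    then have "parcs G = e ` pverts G"
      using sub by auto
    \<comment> \<open>This exhibits the tail of \<open>e v\<close> as the only predecessor of
      \<open>v\<close>.\<close>
    also have "\<dots> = (\<lambda>v. (fst (e v), v)) ` pverts G"
      using e by (intro image_cong) (auto simp: prod_eq_iff)
    finally show False
      using directed_cycleI[OF assms(2), of "\<lambda>v. fst (e v)"] assms(3) by simp
  qed
  then have "resolving_set (line_graph G) ?W"
    using resolving_set_line_graph_omit_in_arcs[OF assms(2) e] by blast
  then have "metric_dimension (line_graph G) = card ?W"
    unfolding metric_dimension_def card
    using resolving_set_line_graph_card_ge card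
    by (intro Least_equality) force+
  then show ?thesis
    using card le by simp
qed

end
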